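(* Let $q$ be a prime power, $m,k,n$ positive integers with $k<n$, and $h$ an integer with $0\le h<k$. Let $\mathcal{C}$ be a nondegenerate $[n,k]_{q^m/q}$ code and $\mathcal{U}$ an $[n,k]_{q^m/q}$ system associated with $\mathcal{C}$. Then $\mathcal{U}$ is $h$-scattered if and only if $\mathrm{Rdef}(\mathcal{C}^\perp)\le\lfloor\frac{km}{n}\rfloor-h-1$.
   Context: An $[n,k]_{q^m/q}$ code is a $k$-dimensional $\mathbb{F}_{q^m}$-subspace of $\mathbb{F}_{q^m}^n$; rank weight of a vector is the $\mathbb{F}_q$-dimension of the $\mathbb{F}_q$-span of its entries; $d_{\mathrm{rk}}(\mathcal{C})$ is the least rank weight of a nonzero codeword. Dual: $\mathcal{C}^\perp=\{v: cv^\top=0\ \forall c\in\mathcal{C}\}$. $\mathcal{C}$ is nondegenerate if the $\mathbb{F}_q$-span of the columns $g_1,\dots,g_n\in\mathbb{F}_{q^m}^k$ of a generator matrix $G$ (rows spanning $\mathcal{C}$) has $\mathbb{F}_q$-dimension $n$; the systems associated with $\mathcal{C}$ are then $\langle g_1,\dots,g_n\rangle_{\mathbb{F}_q}M$, $M\in\mathrm{GL}(k,q^m)$. An $[n,k]_{q^m/q}$ system is an $n$-dimensional $\mathbb{F}_q$-subspace of $\mathbb{F}_{q^m}^k$ spanning it over $\mathbb{F}_{q^m}$; it is $h$-scattered if it meets every $h$-dimensional $\mathbb{F}_{q^m}$-subspace of $\mathbb{F}_{q^m}^k$ in an $\mathbb{F}_q$-subspace of dimension at most $h$. The Singleton rank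 defect of an $[N,K,d]_{q^m/q}$ code $\mathcal{D}$ is $\mathrm{Rdef}(\mathcal{D})=m-\lceil\frac{Km}{N}\rceil-d+1$. *)

theory Defs
  imports "HOL-Analysis.Analysis"
begin

text \<open>
  The extension of fields $\mathbb{F}_{q^m}/\mathbb{F}_q$ is given by two finite field types
  \<open>'q\<close> and \<open>'e\<close> together with an embedding \<open>\<iota> :: 'q \<Rightarrow> 'e\<close>.
  Notions over the large field are those of the library interpretation \<open>vec\<close>; notions over
  the small field are the library's \<^const>\<open>module.subspace\<close>, \<^const>\<open>module.span\<close> and
  \<^const>\<open>vector_space.dim\<close> for scalar multiplication restricted along \<open>\<iota>\<close>.
  The parameters $n$ and $k$ are the cardinalities of the index types \<open>'n\<close> and \<open>'k\<close>.
\<close>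

definition field_embedding :: "('q::field \<Rightarrow> 'e::field) \<Rightarrow> bool" where
  "field_embedding \<iota> \<longleftrightarrow> \<iota> 1 = 1 \<and> (\<forall>x y. \<iota> (x + y) = \<iota> x + \<iota> y) \<and> (\<forall>x y. \<iota> (x * y) = \<iota> x * \<iota> y)"

definition qmult :: "('q::field \<Rightarrow> 'e::field) \<Rightarrow> 'q \<Rightarrow> 'e \<Rightarrow> 'e" where
  "qmult \<iota> a x = \<iota> a * x"

definition qscale :: "('q::field \<Rightarrow> 'e::field) \<Rightarrow> 'q \<Rightarrow> 'e ^ 'i \<Rightarrow> 'e ^ 'i" where
  "qscale \<iota> a v = \<iota> a *s v"

lemma vector_space_qmult: "field_embedding \<iota> \<Longrightarrow> vector_space (qmult \<iota>)"
  by unfold_locales (auto simp: field_embedding_def qmult_def algebra_simps)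

lemma vector_space_qscale: "field_embedding \<iota> \<Longrightarrow> vector_space (qscale \<iota>)"
  by unfold_locales
    (auto simp: field_embedding_def qscale_def vector_add_ldistrib vector_sadd_rdistrib
      vector_smult_assoc)

definition rank_weight :: "('q::field \<Rightarrow> 'e::field) \<Rightarrow> 'e ^ 'n \<Rightarrow> nat" where
  "rank_weight \<iota> v = vector_space.dim (qmult \<iota>) (module.span (qmult \<iota>) (range (\<lambda>j. v $ j)))"

text \<open>Only meaningful for codes containing a nonzero codeword.\<close>

definition min_rank_distance :: "('q::field \<Rightarrow> 'e::field) \<Rightarrow> ('e ^ 'n) set \<Rightarrow> nat" where
  "min_rank_distance \<iota> C = (LEAST d. \<exists>c\<in>C. c \<noteq> 0 \<and> rank_weight \<iota> c = d)"

definition is_code :: "nat \<Rightarrow> ('e::field ^ 'n) set \<Rightarrow> bool" where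
  "is_code k C \<longleftrightarrow> vec.subspace C \<and> vec.dim C = k"

definition dual_code :: "('e::field ^ 'n) set \<Rightarrow> ('e ^ 'n) set" where
  "dual_code C = {v. \<forall>c\<in>C. (\<Sum>j\<in>UNIV. c $ j * v $ j) = 0}"

text \<open>To be used for a code of dimension \<open>CARD('k)\<close>; the rows are then a basis of it.\<close>

definition generator_matrix :: "'e::field ^ 'n ^ 'k \<Rightarrow> ('e ^ 'n) set \<Rightarrow> bool" where
  "generator_matrix G C \<longleftrightarrow> vec.span (rows G) = C"

definition qspan_columns :: "('q::field \<Rightarrow> 'e::field) \<Rightarrow> 'e ^ 'n ^ 'k \<Rightarrow> ('e ^ 'k) set" where
  "qspan_columns \<iota> G = module.span (qscale \<iota>) (columns G)"

text \<open>
  The argument of type \<open>'k itself\<close> records the dimension \<open>CARD('k)\<close> of the code, which is the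
  number of rows of its generator matrices.
\<close>

definition nondegenerate ::
    "('q::field \<Rightarrow> 'e::field) \<Rightarrow> 'k::finite itself \<Rightarrow> ('e ^ 'n) set \<Rightarrow> bool" where
  "nondegenerate \<iota> (_ :: 'k itself) C \<longleftrightarrow>
     (\<exists>G :: 'e ^ 'n ^ 'k. generator_matrix G C \<and>
        vector_space.dim (qscale \<iota>) (qspan_columns \<iota> G) = CARD('n))"

definition is_system :: "('q::field \<Rightarrow> 'e::field) \<Rightarrow> nat \<Rightarrow> ('e ^ 'k) set \<Rightarrow> bool" where
  "is_system \<iota> n U \<longleftrightarrow>
     module.subspace (qscale \<iota>) U \<and> vector_space.dim (qscale \<iota>) U = n \<and> vec.span U = UNIV"

definition associated_system ::
    "('q::field \<Rightarrow> 'e::field) \<Rightarrow> ('e ^ 'n) set \<Rightarrow> ('e ^ 'k) set \<Rightarrow> bool" where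
  "associated_system \<iota> C U \<longleftrightarrow>
     (\<exists>(G :: 'e ^ 'n ^ 'k) (M :: 'e ^ 'k ^ 'k).
        generator_matrix G C \<and> invertible M \<and> U = (\<lambda>u. u v* M) ` qspan_columns \<iota> G)"

definition scattered :: "('q::field \<Rightarrow> 'e::field) \<Rightarrow> nat \<Rightarrow> ('e ^ 'k) set \<Rightarrow> bool" where
  "scattered \<iota> h U \<longleftrightarrow>
     (\<forall>W. vec.subspace W \<and> vec.dim W = h \<longrightarrow> vector_space.dim (qscale \<iota>) (U \<inter> W) \<le> h)"

definition Rdef :: "('q::field \<Rightarrow> 'e::field) \<Rightarrow> nat \<Rightarrow> ('e ^ 'n) set \<Rightarrow> int" where
  "Rdef \<iota> m D =
     int m - \<lceil>real (vec.dim D * m) / real CARD('n)\<rceil> - int (min_rank_distance \<iota> D) + 1"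

end

theory Submission
  imports Defs
begin

text \<open>
  Let $g_1,\ldots,g_n$ be the columns of a generator matrix $G$ whose columns span
  $\mathcal{U}$. Since $\dim \mathcal{C}^\perp = n-k$ and
  $\lceil (n-k)m/n \rceil = m - \lfloor km/n \rfloor$, the bound on the rank defect says exactly
  that $\mathcal{C}^\perp$ has no nonzero vector of rank weight at most $h+1$. On the other side,
  $\mathcal{U}$ is $h$-scattered iff at most $h+1$ vectors of $\mathcal{U}$ that are independent
  over the small field stay independent over the large one. The two conditions match: expanding
  the entries of $v$ with $Gv = 0$ as $v_j = \sum_i a_{ij} \alpha_i$ in a basis $(\alpha_i)$ of
  their span over $\mathbb{F}_q$, the relation $Gv = 0$ reads $\sum_i \alpha_i u_i = 0$ with
  $u_i = \sum_j a_{ij} g_j \in \mathcal{U}$.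
\<close>

section \<open>Linear algebra\<close>

text \<open>Every basis is finite because the type is; this opens the finite-dimensional theory for
  \<open>qscale\<close>, which comes without a distinguished basis.\<close>

lemma (in vector_space) finite_dimensional_if_finite:
  assumes "finite (UNIV :: 'b set)"
  shows "\<exists>B. finite_dimensional_vector_space scale B"
proof -
  obtain B where "independent B" "UNIV \<subseteq> span B"
    using maximal_independent_subset by blast
  then have "finite_dimensional_vector_space scale B"
    using assms finite_subset[of B UNIV] by unfold_locales auto
  then show ?thesis ..
qed

text \<open>Any set between \<open>S\<close> and a maximal independent subset of \<open>V\<close>
  extending \<open>S\<close> is independent, so the size can be chosen freely.\<close>

lemma (in finite_dimensional_vector_space) exists_independent_between:
  assumes "S \<subseteq> V" "independent S" "card S \<le> c" "c \<le> dim V"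
  obtains T where "S \<subseteq> T" "T \<subseteq> V" "independent T" "card T = c"
proof -
  obtain B where B: "S \<subseteq> B" "B \<subseteq> V" "independent B" "V \<subseteq> span B"
    using maximal_independent_subset_extend[OF assms(1,2)] .
  have "card B = dim V"
    using B by (simp add: basis_card_eq_dim)
  then obtain T where T: "S \<subseteq> T" "T \<subseteq> B" "card T = c"
    using exists_subset_between[of S c B] assms(3,4) B finiteI_independent by metis
  moreover have "independent T"
    using B(3) T(2) by (rule independent_mono)
  ultimately show thesis
    using that[of T] B(2) by simp
qed

lemma (in finite_dimensional_vector_space) exists_subspace_above:
  assumes "dim S \<le> c" "c \<le> dimension"
  obtains W where "S \<subseteq> W" "subspace W" "dim W = c"
proof -
  obtain B where B: "B \<subseteq> S" "independent B" "S \<subseteq> span B" "card B = dim S"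
    using basis_exists by blast
  obtain T where T: "B \<subseteq> T" "independent T" "card T = c"
    using exists_independent_between[of B UNIV c] B assms by (auto simp: dimension_def)
  show thesis
    using that[of "span T"] T B span_mono[OF T(1)] by (auto simp: dim_eq_card_independent)
qed

text \<open>Rank-nullity: extend a basis \<open>A\<close> of the kernel to a basis \<open>B\<close>
  of the domain; the images of \<open>B - A\<close> form a basis of the range.\<close>

lemma (in finite_dimensional_vector_space_pair_1) dim_range_add_dim_kernel:
  assumes "Vector_Spaces.linear s1 s2 f"
  shows "vs2.dim (range f) + vs1.dim {x. f x = 0} = vs1.dimension"
proof -
  interpret f: Vector_Spaces.linear s1 s2 f by fact
  let ?K = "{x. f x = 0}"
  have K: "vs1.subspace ?K"
    by (rule f.subspace_kernel)
  obtain A where A: "A \<subseteq> ?K" "vs1.independent A" "?K \<subseteq> vs1.span A" "card A = vs1.dim ?K"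
    using vs1.basis_exists by blast
  obtain B where B: "A \<subseteq> B" "vs1.independent B" "UNIV \<subseteq> vs1.span B"
    using vs1.maximal_independent_subset_extend[of A UNIV] A by auto
  have fin: "finite B"
    using B vs1.finiteI_independent by blast
  have card: "card B = vs1.dimension"
    using vs1.basis_card_eq_dim[of B UNIV] B by (simp add: vs1.dimension_def)
  \<comment> \<open>The coordinates in \<open>B\<close> of a common vector are supported both in
    \<open>A\<close> and in \<open>B - A\<close>, hence vanish.\<close>
  have inter: "vs1.span A \<inter> vs1.span (B - A) \<subseteq> {0}"
  proof
    fix x assume x: "x \<in> vs1.span A \<inter> vs1.span (B - A)"
    have "vs1.representation B x = vs1.representation A x"
      "vs1.representation B x = vs1.representation (B - A) x"
      using x B by (auto intro!: vs1.representation_extend)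
    then have "vs1.representation B x = (\<lambda>b. 0)"
      using vs1.representation_ne_zero by (metis DiffD2)
    moreover have "(\<Sum>b\<in>B. s1 (vs1.representation B x b) b) = x"
      using vs1.sum_representation_eq[of B x B] B fin by auto
    ultimately show "x \<in> {0}"
      by simp
  qed
  have "inj_on f (vs1.span (B - A))"
  proof (rule inj_onI)
    fix x y assume xy: "x \<in> vs1.span (B - A)" "y \<in> vs1.span (B - A)" "f x = f y"
    then have "x - y \<in> vs1.span A"
      using A by (auto simp: f.diff)
    then show "x = y"
      using inter xy vs1.span_diff by fastforce
  qed
  then have "vs2.dim (f ` (B - A)) = card (B - A)"
    using dim_image_eq[OF assms] B vs1.independent_mono[of B "B - A"]
    by (simp add: vs1.dim_eq_card_independent)
  moreover have "range f = vs2.span (f ` (B - A))"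
  proof -
    have "range f = vs2.span (f ` B)"
      using B by (simp add: f.span_image top.extremum_unique)
    also have "\<dots> = vs2.span (f ` (B - A))"
    proof (rule antisym)
      have "f ` B \<subseteq> vs2.span (f ` (B - A))"
      proof (rule image_subsetI)
        fix x assume "x \<in> B"
        then show "f x \<in> vs2.span (f ` (B - A))"
          using A vs2.span_zero vs2.span_base[of "f x" "f ` (B - A)"] by (cases "x \<in> A") auto
      qed
      then show "vs2.span (f ` B) \<subseteq> vs2.span (f ` (B - A))"
        by (simp add: vs2.span_minimal)
    qed (simp add: vs2.span_mono image_mono)
    finally show ?thesis .
  qed
  ultimately show ?thesis
    using A(4) B(1) card fin card_mono[OF fin B(1)]
    by (simp add: card_Diff_subset finite_subset)
qed

text \<open>Rank-nullity with rank \<open>CARD('m)\<close>; surjectivity forces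
  \<open>CARD('m) \<le> CARD('n)\<close>, so the subtraction does not truncate.\<close>

lemma dim_kernel_surjective_matrix:
  fixes A :: "'a::field ^ 'n ^ 'm"
  assumes "surj ((*v) A)"
  shows "vec.dim {x. A *v x = 0} = CARD('n) - CARD('m)"
  using vec.dim_range_add_dim_kernel[OF matrix_vector_mul_linear_gen, of A] assms
  by (simp add: vec.dimension_def card_cart_basis)

section \<open>Fields as vector spaces over a subfield\<close>

lemma field_embedding_hom:
  assumes "field_embedding \<iota>"
  shows "\<iota> 0 = 0" "\<iota> 1 = 1" "\<iota> (x + y) = \<iota> x + \<iota> y" "\<iota> (x * y) = \<iota> x * \<iota> y"
    "\<iota> (- x) = - \<iota> x" "\<iota> (x - y) = \<iota> x - \<iota> y" "\<iota> (sum f A) = (\<Sum>i\<in>A. \<iota> (f i))"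
proof -
  have add: "\<iota> (x + y) = \<iota> x + \<iota> y" for x y
    using assms by (simp add: field_embedding_def)
  show zero: "\<iota> 0 = 0"
    using add[of 0 0] by (metis add_0 add_right_cancel)
  show neg: "\<iota> (- x) = - \<iota> x" for x
    using add[of x "- x"] zero by (metis add.right_inverse minus_unique)
  show "\<iota> (x - y) = \<iota> x - \<iota> y"
    using add[of x "- y"] neg by simp
  show "\<iota> (sum f A) = (\<Sum>i\<in>A. \<iota> (f i))"
    by (induction A rule: infinite_finite_induct) (simp_all add: zero add)
qed (use assms in \<open>simp_all add: field_embedding_def\<close>)

lemma field_embedding_eq_0_iff:
  assumes "field_embedding \<iota>"
  shows "\<iota> x = 0 \<longleftrightarrow> x = 0"
proof
  assume "\<iota> x = 0"
  moreover have "\<iota> x * \<iota> (inverse x) = 1" if "x \<noteq> 0"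
    using that field_embedding_hom[OF assms] by (metis right_inverse)
  ultimately show "x = 0"
    by force
qed (simp add: field_embedding_hom(1)[OF assms])

lemma finite_dimensional_qscale:
  fixes \<iota> :: "'q::field \<Rightarrow> 'e::{field,finite}"
  assumes "field_embedding \<iota>"
  obtains B where "finite_dimensional_vector_space (qscale \<iota> :: 'q \<Rightarrow> 'e ^ 'i \<Rightarrow> 'e ^ 'i) B"
  using vector_space.finite_dimensional_if_finite[OF vector_space_qscale[OF assms]] by auto

section \<open>Scattered systems\<close>

text \<open>A set of \<open>h + 1\<close> vectors of \<open>U\<close> that is independent over the
  small field but dependent over the large one lies in an \<open>h\<close>-dimensional subspace,
  which then meets \<open>U\<close> in too large a space; conversely, too large an intersection
  contains such a set.\<close>

lemma scattered_iff_independent: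
  fixes \<iota> :: "'q::field \<Rightarrow> 'e::{field,finite}" and U :: "('e ^ 'k) set"
  assumes \<iota>: "field_embedding \<iota>"
    and h: "h < CARD('k)" "h < vector_space.dim (qscale \<iota>) U"
  shows "scattered \<iota> h U \<longleftrightarrow>
    (\<forall>S\<subseteq>U. \<not> module.dependent (qscale \<iota>) S \<and> card S \<le> Suc h \<longrightarrow> vec.independent S)"
proof -
  obtain B where "finite_dimensional_vector_space (qscale \<iota> :: 'q \<Rightarrow> 'e ^ 'k \<Rightarrow> 'e ^ 'k) B"
    using finite_dimensional_qscale[OF \<iota>] .
  then interpret Q: finite_dimensional_vector_space "qscale \<iota> :: 'q \<Rightarrow> 'e ^ 'k \<Rightarrow> 'e ^ 'k" B .
  show ?thesis
  proof (intro iffI allI impI)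
    fix S
    assume sc: "scattered \<iota> h U" and SU: "S \<subseteq> U" and S: "Q.independent S \<and> card S \<le> Suc h"
    \<comment> \<open>Enlarging \<open>S\<close> to exactly \<open>h + 1\<close> vectors, possible
      as \<open>h\<close> is below the dimension of \<open>U\<close>, makes dependence mean
      dimension at most \<open>h\<close>.\<close>
    obtain T where T: "S \<subseteq> T" "T \<subseteq> U" "Q.independent T" "card T = Suc h"
      using Q.exists_independent_between[of S U "Suc h"] S SU h(2) by auto
    have "vec.independent T"
    proof (rule ccontr)
      assume "\<not> vec.independent T"
      then have "vec.dim T \<noteq> card T"
        using vec.card_le_dim_spanning[of T T] by (auto simp: vec.span_superset)
      moreover have "vec.dim T \<le> card T"
        by (rule vec.dim_le_card) (auto simp: vec.span_superset)
      ultimately have "vec.dim T \<le> h"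
        using T by simp
      \<comment> \<open>\<open>scattered\<close> tests only dimension exactly \<open>h\<close>, so
        the span of \<open>T\<close> may have to be enlarged.\<close>
      then obtain W where W: "T \<subseteq> W" "vec.subspace W" "vec.dim W = h"
        using vec.exists_subspace_above[of T h] h(1)
        by (auto simp: vec.dimension_def card_cart_basis)
      have "Suc h \<le> Q.dim (U \<inter> W)"
        using Q.independent_card_le_dim[of T "U \<inter> W"] T W by auto
      then show False
        using sc W by (auto simp: scattered_def)
    qed
    then show "vec.independent S"
      using T vec.independent_mono by blast
  next
    assume ind: "\<forall>S\<subseteq>U. Q.independent S \<and> card S \<le> Suc h \<longrightarrow> vec.independent S"
    show "scattered \<iota> h U"
      unfolding scattered_def
    proof (intro allI impI, rule ccontr)
      fix W :: "('e ^ 'k) set"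
      assume W: "vec.subspace W \<and> vec.dim W = h" and "\<not> Q.dim (U \<inter> W) \<le> h"
      then obtain S where S: "S \<subseteq> U \<inter> W" "Q.independent S" "card S = Suc h"
        using Q.exists_independent_between[of "{}" "U \<inter> W" "Suc h"]
        by (metis Q.independent_empty card.empty empty_subsetI not_less_eq_eq zero_le)
      then have "vec.independent S"
        using ind by auto
      then show False
        using vec.independent_card_le_dim[of S W] S W by auto
    qed
  qed
qed

section \<open>Low-weight vectors in the kernel of a generator matrix\<close>

text \<open>There are as many columns as the dimension of their span, so they are distinct and
  independent over the small field.\<close>

lemma columns_combination_eq_0:
  fixes \<iota> :: "'q::field \<Rightarrow> 'e::{field,finite}" and G :: "'e ^ 'n ^ 'k"
  assumes \<iota>: "field_embedding \<iota>"
    and dim: "vector_space.dim (qscale \<iota>) (qspan_columns \<iota> G) = CARD('n)"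
    and zero: "G *v (\<chi> j. \<iota> (a j)) = 0"
  shows "a j = 0"
proof -
  obtain B where "finite_dimensional_vector_space (qscale \<iota> :: 'q \<Rightarrow> 'e ^ 'k \<Rightarrow> 'e ^ 'k) B"
    using finite_dimensional_qscale[OF \<iota>] .
  then interpret Q: finite_dimensional_vector_space "qscale \<iota> :: 'q \<Rightarrow> 'e ^ 'k \<Rightarrow> 'e ^ 'k" B .
  let ?g = "\<lambda>j. column j G"
  have cols: "columns G = range ?g"
    by (auto simp: columns_def)
  have dim': "Q.dim (range ?g) = CARD('n)"
    using dim by (simp add: qspan_columns_def cols)
  \<comment> \<open>Independence is a property of the set of columns, so repeated columns have to be
    excluded separately.\<close>
  have "CARD('n) \<le> card (range ?g)"
    using Q.dim_le_card[of "range ?g" "range ?g"] dim' by (simp add: Q.span_superset)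
  then have card: "card (range ?g) = CARD('n)"
    using card_image_le[of UNIV ?g] by simp
  then have inj: "inj ?g"
    by (simp add: eq_card_imp_inj_on)
  have ind: "Q.independent (range ?g)"
    using Q.card_le_dim_spanning[of "range ?g" "range ?g"] dim' card by (simp add: Q.span_superset)
  have "(\<Sum>w\<in>range ?g. qscale \<iota> (a (inv ?g w)) w) = (\<Sum>j\<in>UNIV. qscale \<iota> (a j) (?g j))"
    by (simp add: sum.reindex[OF inj] inv_f_f[OF inj])
  also have "\<dots> = 0"
    using zero by (simp add: matrix_mult_sum qscale_def)
  finally have "a (inv ?g (?g j)) = 0"
    using Q.independentD[OF ind, of "range ?g" "\<lambda>w. a (inv ?g w)" "?g j"] by simp
  then show ?thesis
    by (simp add: inv_f_f[OF inj])
qed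

text \<open>Puts an element of the system in the form \<open>G *v x\<close> with the entries of
  \<open>x\<close> in the image of \<iota>, so that combinations over either field can be moved
  through \<open>G\<close>.\<close>

lemma qspan_columns_eq_range:
  fixes \<iota> :: "'q::field \<Rightarrow> 'e::field" and G :: "'e ^ 'n ^ 'k"
  assumes \<iota>: "field_embedding \<iota>"
  shows "qspan_columns \<iota> G = range (\<lambda>a. G *v (\<chi> j. \<iota> (a j)))" (is "_ = ?R")
proof -
  interpret Q: vector_space "qscale \<iota> :: 'q \<Rightarrow> 'e ^ 'k \<Rightarrow> 'e ^ 'k"
    by (rule vector_space_qscale[OF \<iota>])
  have R: "G *v (\<chi> j. \<iota> (a j)) = (\<Sum>j\<in>UNIV. qscale \<iota> (a j) (column j G))" for a
    by (simp add: matrix_mult_sum qscale_def)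
  show ?thesis
    unfolding qspan_columns_def
  proof (rule Q.span_unique)
    show "columns G \<subseteq> ?R"
    proof
      fix w assume "w \<in> columns G"
      then obtain i where w: "w = column i G"
        by (auto simp: columns_def)
      have "qscale \<iota> (if j = i then 1 else 0) (column j G) = (if j = i then column j G else 0)" for j
        by simp
      then have "w = G *v (\<chi> j. \<iota> (if j = i then 1 else 0))"
        unfolding R by (simp add: w)
      then show "w \<in> ?R" 
        by (rule range_eqI[of _ _ "\<lambda>j. if j = i then 1 else 0"])
    qed
    show "Q.subspace ?R"
    proof (rule Q.subspaceI)
      show "0 \<in> ?R"
        by (rule range_eqI[of _ _ "\<lambda>_. 0"]) (simp add: R)
    next
      fix x y assume "x \<in> ?R" "y \<in> ?R"
      then obtain a b where "x = G *v (\<chi> j. \<iota> (a j))" "y = G *v (\<chi> j. \<iota> (b j))"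
        by blast
      then show "x + y \<in> ?R"
        by (intro range_eqI[of _ _ "\<lambda>j. a j + b j"]) (simp add: R Q.scale_left_distrib sum.distrib)
    next
      fix c x assume "x \<in> ?R"
      then obtain a where "x = G *v (\<chi> j. \<iota> (a j))"
        by blast
      then show "qscale \<iota> c x \<in> ?R"
        by (intro range_eqI[of _ _ "\<lambda>j. c * a j"]) (simp add: R Q.scale_sum_right)
    qed
  next
    fix T assume T: "columns G \<subseteq> T" "Q.subspace T"
    then have "(\<Sum>j\<in>UNIV. qscale \<iota> (a j) (column j G)) \<in> T" for a
      by (intro Q.subspace_sum Q.subspace_scale) (auto simp: columns_def)
    then show "?R \<subseteq> T"
      by (auto simp: R)
  qed
qed

text \<open>The relation \<open>G *v v = 0\<close> becomes a relation among the vectors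
  \<open>u b\<close> whose coefficients are the basis elements \<open>b\<close> themselves; these
  are nonzero, so the vectors are dependent over the large field.\<close>

lemma dependent_set_of_kernel_vector:
  fixes \<iota> :: "'q::field \<Rightarrow> 'e::{field,finite}" and G :: "'e ^ 'n ^ 'k"
  assumes \<iota>: "field_embedding \<iota>"
    and dim: "vector_space.dim (qscale \<iota>) (qspan_columns \<iota> G) = CARD('n)"
    and v: "G *v v = 0" "v \<noteq> 0"
  obtains S where "S \<subseteq> qspan_columns \<iota> G" "\<not> module.dependent (qscale \<iota>) S"
    "card S = rank_weight \<iota> v" "vec.dependent S"
proof -
  interpret Q: vector_space "qscale \<iota> :: 'q \<Rightarrow> 'e ^ 'k \<Rightarrow> 'e ^ 'k"
    by (rule vector_space_qscale[OF \<iota>])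
  interpret E: vector_space "qmult \<iota>"
    by (rule vector_space_qmult[OF \<iota>])
  note hom = field_embedding_hom[OF \<iota>]
  obtain B where B: "B \<subseteq> range (($) v)" "E.independent B" "range (($) v) \<subseteq> E.span B"
    and cardB: "card B = E.dim (range (($) v))"
    using E.basis_exists by blast
  have rk: "rank_weight \<iota> v = card B"
    by (simp add: rank_weight_def cardB)
  define a where "a b j = E.representation B (v $ j) b" for b j
  define u where "u b = G *v (\<chi> j. \<iota> (a b j))" for b
  \<comment> \<open>As the basis \<open>B\<close> consists of entries of \<open>v\<close>, the coefficient matrix \<open>a\<close> contains an identity
    matrix, so the vectors \<open>u b\<close> are independent over the small field.\<close>
  have delta: "\<exists>j. \<forall>b'. a b' j = (if b' = b then 1 else 0)" if b: "b \<in> B" for b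
  proof -
    obtain j where "v $ j = b"
      using b B(1) by auto
    then show ?thesis
      using E.representation_basis[OF B(2) b] by (intro exI[of _ j]) (simp add: a_def)
  qed
  have expand: "(\<Sum>b\<in>B. b * \<iota> (a b j)) = v $ j" for j
    using E.sum_representation_eq[of B "v $ j" B] B
    by (auto simp: a_def qmult_def mult.commute)
  \<comment> \<open>Equal images would make the coordinates for \<open>b\<close> and
    \<open>b'\<close> agree at every entry of \<open>v\<close>, but for distinct \<open>b\<close>
    and \<open>b'\<close> they differ at an entry equal to \<open>b\<close>. So the set of the
    \<open>u b\<close> has exactly \<open>rank_weight \<iota> v\<close> elements.\<close>
  have inj: "inj_on u B"
  proof (rule inj_onI)
    fix b b' assume b: "b \<in> B" and b': "b' \<in> B" and eq: "u b = u b'"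
    have "(\<chi> j. \<iota> (a b j - a b' j)) = (\<chi> j. \<iota> (a b j)) - (\<chi> j. \<iota> (a b' j))"
      by (simp add: vec_eq_iff hom)
    then have "G *v (\<chi> j. \<iota> (a b j - a b' j)) = u b - u b'"
      by (simp add: u_def matrix_vector_mult_diff_distrib)
    then have "a b j - a b' j = 0" for j
      using columns_combination_eq_0[OF \<iota> dim, of "\<lambda>j. a b j - a b' j"] eq by simp
    moreover obtain j where "\<forall>b'. a b' j = (if b' = b then 1 else 0)"
      using delta[OF b] ..
    ultimately show "b = b'"
      by (metis eq_iff_diff_eq_0 zero_neq_one)
  qed
  have "Q.independent (u ` B)"
  proof
    assume "Q.dependent (u ` B)"
    then obtain c where c: "\<exists>x\<in>u ` B. c x \<noteq> 0" and "(\<Sum>x\<in>u ` B. qscale \<iota> (c x) x) = 0"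
      by (auto simp: Q.dependent_finite)
    then have "0 = (\<Sum>b\<in>B. qscale \<iota> (c (u b)) (u b))"
      by (simp add: sum.reindex[OF inj])
    also have "\<dots> = G *v (\<Sum>b\<in>B. \<iota> (c (u b)) *s (\<chi> j. \<iota> (a b j)))"
      by (simp add: vec.sum vec.scale u_def qscale_def)
    \<comment> \<open>The coefficients \<open>c (u b)\<close> and \<open>a b j\<close> both come
      from the small field, so the independence of the columns applies.\<close>
    also have "(\<Sum>b\<in>B. \<iota> (c (u b)) *s (\<chi> j. \<iota> (a b j))) = (\<chi> j. \<iota> (\<Sum>b\<in>B. c (u b) * a b j))"
      by (simp add: vec_eq_iff hom)
    finally have zero: "(\<Sum>b\<in>B. c (u b) * a b j) = 0" for j
      using columns_combination_eq_0[OF \<iota> dim, of "\<lambda>j. \<Sum>b\<in>B. c (u b) * a b j"] by simp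
    obtain b where b: "b \<in> B" "c (u b) \<noteq> 0"
      using c by blast
    obtain j where j: "\<And>b'. a b' j = (if b' = b then 1 else 0)"
      using delta[OF b(1)] by blast
    have "(\<Sum>b'\<in>B. c (u b') * a b' j) = (\<Sum>b'\<in>B. if b' = b then c (u b') else 0)"
      by (intro sum.cong) (simp_all add: j)
    then show False
      using zero[of j] b by simp
  qed
  moreover have "vec.dependent (u ` B)"
  proof -
    have "(\<Sum>b\<in>B. b *s u b) = G *v (\<Sum>b\<in>B. b *s (\<chi> j. \<iota> (a b j)))"
      by (simp add: vec.sum vec.scale u_def)
    also have "(\<Sum>b\<in>B. b *s (\<chi> j. \<iota> (a b j))) = v"
      using expand by (simp add: vec_eq_iff)
    finally have "(\<Sum>x\<in>u ` B. inv_into B u x *s x) = 0"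
      using v by (simp add: sum.reindex[OF inj] inj)
    \<comment> \<open>A basis element exists since \<open>v\<close> is nonzero; it provides a
      nonzero coefficient of the relation.\<close>
    moreover obtain b where "b \<in> B"
      using expand v(2) by (force simp: vec_eq_iff)
    moreover have "0 \<notin> B"
      using B(2) E.dependent_zero by blast
    ultimately show ?thesis
      using inj by (auto simp: vec.dependent_finite intro!: exI[of _ "inv_into B u"] bexI[of _ b])
  qed
  moreover have "u ` B \<subseteq> qspan_columns \<iota> G"
    unfolding qspan_columns_eq_range[OF \<iota>] by (auto simp: u_def)
  moreover have "card (u ` B) = rank_weight \<iota> v"
    using rk inj by (simp add: card_image)
  ultimately show thesis
    using that by blast
qed

text \<open>Writing each \<open>s\<close> as \<open>G\<close> applied to a coefficient vector turns
  a relation \<open>f\<close> on \<open>S\<close> into a vector of the kernel. Its entries are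
  combinations of the scalars \<open>f s\<close> over the small field; as these scalars may coincide
  or be dependent, only an upper bound on the weight results.\<close>

lemma kernel_vector_of_dependent_set:
  fixes \<iota> :: "'q::field \<Rightarrow> 'e::{field,finite}" and G :: "'e ^ 'n ^ 'k"
  assumes \<iota>: "field_embedding \<iota>"
    and S: "S \<subseteq> qspan_columns \<iota> G" "\<not> module.dependent (qscale \<iota>) S" "vec.dependent S"
  obtains v where "G *v v = 0" "v \<noteq> 0" "rank_weight \<iota> v \<le> card S"
proof -
  interpret Q: vector_space "qscale \<iota> :: 'q \<Rightarrow> 'e ^ 'k \<Rightarrow> 'e ^ 'k"
    by (rule vector_space_qscale[OF \<iota>])
  interpret E: vector_space "qmult \<iota>"
    by (rule vector_space_qmult[OF \<iota>])
  note hom = field_embedding_hom[OF \<iota>]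
  obtain f where f: "\<exists>s\<in>S. f s \<noteq> 0" "(\<Sum>s\<in>S. f s *s s) = 0"
    using S(3) by (auto simp: vec.dependent_finite)
  have "\<forall>s\<in>S. \<exists>a. s = G *v (\<chi> j. \<iota> (a j))"
    using S(1) qspan_columns_eq_range[OF \<iota>, of G] by blast
  then obtain a where a: "\<And>s. s \<in> S \<Longrightarrow> s = G *v (\<chi> j. \<iota> (a s j))"
    by metis
  define v where "v = (\<Sum>s\<in>S. f s *s (\<chi> j. \<iota> (a s j)))"
  have vj: "v $ j = (\<Sum>s\<in>S. qmult \<iota> (a s j) (f s))" for j
    by (simp add: v_def qmult_def mult.commute)
  have "G *v v = (\<Sum>s\<in>S. f s *s (G *v (\<chi> j. \<iota> (a s j))))"
    by (simp add: v_def vec.sum vec.scale)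
  also have "\<dots> = (\<Sum>s\<in>S. f s *s s)"
    using a by (intro sum.cong) auto
  finally have "G *v v = 0"
    using f(2) by simp
  moreover have "v \<noteq> 0"
  proof
    assume "v = 0"
    obtain s0 where s0: "s0 \<in> S" "f s0 \<noteq> 0"
      using f(1) by blast
    obtain B where B: "E.independent B" "UNIV \<subseteq> E.span B"
      using E.maximal_independent_subset by blast
    let ?r = "E.representation B"
    have span: "x \<in> E.span B" for x
      using B by blast
    \<comment> \<open>A coordinate functional that does not vanish at \<open>f s0\<close> turns the vanishing of \<open>v\<close>
      into a nontrivial relation on \<open>S\<close> over the small field.\<close>
    obtain b where b: "?r (f s0) b \<noteq> 0"
      using E.sum_representation_eq[OF B(1) span, of B "f s0"] s0 by force
    have rel: "(\<Sum>s\<in>S. a s j * ?r (f s) b) = 0" for j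
    proof -
      have "0 = ?r (\<Sum>s\<in>S. qmult \<iota> (a s j) (f s)) b"
        using vj[of j] \<open>v = 0\<close> by (simp add: E.representation_zero)
      also have "\<dots> = (\<Sum>s\<in>S. a s j * ?r (f s) b)"
        using B(1) span by (simp add: E.representation_sum E.representation_scale)
      finally show ?thesis
        by simp
    qed
    \<comment> \<open>\<open>G\<close> carries the relation between the coefficient vectors over to
      the elements of \<open>S\<close> themselves.\<close>
    have "(\<Sum>s\<in>S. qscale \<iota> (?r (f s) b) s)
        = (\<Sum>s\<in>S. \<iota> (?r (f s) b) *s (G *v (\<chi> j. \<iota> (a s j))))"
      using a by (intro sum.cong) (auto simp: qscale_def)
    also have "\<dots> = G *v (\<Sum>s\<in>S. \<iota> (?r (f s) b) *s (\<chi> j. \<iota> (a s j)))"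
      by (simp add: vec.sum vec.scale)
    also have "(\<Sum>s\<in>S. \<iota> (?r (f s) b) *s (\<chi> j. \<iota> (a s j)))
        = (\<chi> j. \<iota> (\<Sum>s\<in>S. a s j * ?r (f s) b))"
      by (simp add: vec_eq_iff hom mult.commute)
    also have "\<dots> = 0"
      unfolding rel by (simp add: vec_eq_iff hom)
    finally have "(\<Sum>s\<in>S. qscale \<iota> (?r (f s) b) s) = 0"
      by simp
    then show False
      using Q.independentD[OF S(2), of S "\<lambda>s. ?r (f s) b" s0] s0 b by simp
  qed
  moreover have "rank_weight \<iota> v \<le> card S"
  proof -
    have "range (($) v) \<subseteq> E.span (f ` S)"
    proof (rule image_subsetI)
      show "v $ j \<in> E.span (f ` S)" for j
        unfolding vj by (intro E.span_sum E.span_scale E.span_base imageI)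
    qed
    then have "E.dim (range (($) v)) \<le> card (f ` S)"
      by (simp add: E.dim_le_card)
    then show ?thesis
      using card_image_le[of S f] by (simp add: rank_weight_def)
  qed
  ultimately show thesis
    using that by blast
qed

section \<open>Dual codes and associated systems\<close>

text \<open>Orthogonality to a fixed \<open>v\<close> is a linear condition on the codeword, so
  testing the rows of \<open>G\<close> suffices.\<close>

lemma dual_code_eq_kernel:
  assumes "generator_matrix G C"
  shows "dual_code C = {v. G *v v = 0}"
proof (intro set_eqI iffI)
  fix v assume v: "v \<in> dual_code C"
  have "row i G \<in> C" for i
    using assms vec.span_base[of "row i G" "rows G"] by (auto simp: generator_matrix_def rows_def)
  then have "(\<Sum>j\<in>UNIV. G $ i $ j * v $ j) = 0" for i
    using v by (force simp: dual_code_def row_def)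
  then show "v \<in> {v. G *v v = 0}"
    by (simp add: matrix_vector_mult_def vec_eq_iff)
next
  fix v assume v: "v \<in> {v. G *v v = 0}"
  let ?P = "{c. (\<Sum>j\<in>UNIV. c $ j * v $ j) = 0}"
  have "vec.subspace ?P"
    by (auto simp: vec.subspace_def distrib_right sum.distrib mult.assoc
        simp flip: sum_distrib_left)
  moreover have "rows G \<subseteq> ?P"
    using v by (auto simp: rows_def row_def matrix_vector_mult_def vec_eq_iff)
  ultimately have "C \<subseteq> ?P"
    using assms vec.span_minimal by (auto simp: generator_matrix_def)
  then show "v \<in> dual_code C"
    by (auto simp: dual_code_def)
qed

lemma qspan_columns_mult:
  fixes \<iota> :: "'q::field \<Rightarrow> 'e::field" and G :: "'e ^ 'n ^ 'k"
  assumes "field_embedding \<iota>"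
  shows "(\<lambda>u. u v* M) ` qspan_columns \<iota> G = qspan_columns \<iota> (transpose M ** G)"
  unfolding qspan_columns_eq_range[OF assms] image_image
  by (simp only: matrix_vector_mul_assoc flip: transpose_matrix_vector)

text \<open>The change of basis \<open>M\<close> is absorbed into the generator matrix:
  \<open>transpose M ** G\<close> has the same kernel as \<open>G\<close> because
  \<open>transpose M\<close> is injective. One matrix then describes both the system and the dual
  code.\<close>

lemma associated_system_matrix:
  fixes \<iota> :: "'q::field \<Rightarrow> 'e::field" and U :: "('e ^ 'k) set" and C :: "('e ^ 'n) set"
  assumes \<iota>: "field_embedding \<iota>" and "associated_system \<iota> C U"
  obtains G :: "'e ^ 'n ^ 'k" where "U = qspan_columns \<iota> G" "dual_code C = {v. G *v v = 0}"
proof -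
  obtain G :: "'e ^ 'n ^ 'k" and M :: "'e ^ 'k ^ 'k" where
    G: "generator_matrix G C" and M: "invertible M" and U: "U = (\<lambda>u. u v* M) ` qspan_columns \<iota> G"
    using assms(2) by (auto simp: associated_system_def)
  obtain N where "M ** N = mat 1"
    using M unfolding invertible_def by blast
  then have "transpose N ** transpose M = mat 1"
    by (metis matrix_transpose_mul transpose_mat)
  then have "transpose M *v x = 0 \<longleftrightarrow> x = 0" for x
    by (metis matrix_left_invertible_ker matrix_vector_mult_0_right)
  then have "dual_code C = {v. (transpose M ** G) *v v = 0}"
    unfolding dual_code_eq_kernel[OF G] by (simp flip: matrix_vector_mul_assoc)
  then show thesis
    using that U qspan_columns_mult[OF \<iota>] by blast
qed

text \<open>The range of \<open>G\<close> is a subspace over the large field that contains a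
  spanning set. Surjectivity yields the dimension of the dual code.\<close>

lemma surj_if_span_qspan_columns:
  fixes G :: "'e::field ^ 'n ^ 'k"
  assumes "field_embedding \<iota>" and "vec.span (qspan_columns \<iota> G) = UNIV"
  shows "surj ((*v) G)"
proof -
  have "vec.subspace (range ((*v) G))"
    by (simp add: vec.subspace_image)
  then show ?thesis
    using assms(2) vec.span_minimal[of "qspan_columns \<iota> G" "range ((*v) G)"]
    unfolding qspan_columns_eq_range[OF assms(1)] by blast
qed

section \<open>Minimum distance and rank defect of the dual code\<close>

text \<open>A nonzero codeword guarantees that the \<open>LEAST\<close> in the definition is
  attained.\<close>

lemma min_rank_distance_le_iff:
  assumes "\<exists>c\<in>C. c \<noteq> 0"
  shows "min_rank_distance \<iota> C \<le> d \<longleftrightarrow> (\<exists>c\<in>C. c \<noteq> 0 \<and> rank_weight \<iota> c \<le> d)"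
proof
  have "\<exists>d. \<exists>c\<in>C. c \<noteq> 0 \<and> rank_weight \<iota> c = d"
    using assms by blast
  from LeastI_ex[OF this]
  obtain c where "c \<in> C" "c \<noteq> 0" "rank_weight \<iota> c = min_rank_distance \<iota> C"
    unfolding min_rank_distance_def by blast
  then show "\<exists>c\<in>C. c \<noteq> 0 \<and> rank_weight \<iota> c \<le> d" if "min_rank_distance \<iota> C \<le> d"
    using that by auto
next
  assume "\<exists>c\<in>C. c \<noteq> 0 \<and> rank_weight \<iota> c \<le> d"
  then obtain c where c: "c \<in> C" "c \<noteq> 0" and le: "rank_weight \<iota> c \<le> d"
    by blast
  have "min_rank_distance \<iota> C \<le> rank_weight \<iota> c"
    unfolding min_rank_distance_def by (rule Least_le) (use c in blast)
  then show "min_rank_distance \<iota> C \<le> d"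
    using le by simp
qed

theorem theorem6p2:
  fixes \<iota> :: "'q::{field,finite} \<Rightarrow> 'e::{field,finite}"
    and q m h :: nat
    and C :: "('e ^ 'n) set"
    and U :: "('e ^ 'k) set"
  assumes "CARD('q) = q" and "CARD('e) = q ^ m" and "0 < m"
    and "field_embedding \<iota>"
    and "CARD('k) < CARD('n)"
    and "h < CARD('k)"
    and "is_code CARD('k) C"
    and "nondegenerate \<iota> TYPE('k) C"
    and "is_system \<iota> CARD('n) U"
    and "associated_system \<iota> C U"
  shows "scattered \<iota> h U \<longleftrightarrow>
    Rdef \<iota> m (dual_code C) \<le> \<lfloor>real (CARD('k) * m) / real CARD('n)\<rfloor> - int h - 1"
proof -
  note \<iota> = \<open>field_embedding \<iota>\<close> and kn = \<open>CARD('k) < CARD('n)\<close> and hk = \<open>h < CARD('k)\<close>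
  obtain G :: "'e ^ 'n ^ 'k" where U: "U = qspan_columns \<iota> G"
    and dual: "dual_code C = {v. G *v v = 0}"
    using associated_system_matrix[OF \<iota> \<open>associated_system \<iota> C U\<close>] .
  have dimU: "vector_space.dim (qscale \<iota>) (qspan_columns \<iota> G) = CARD('n)"
    and "vec.span (qspan_columns \<iota> G) = UNIV"
    using \<open>is_system \<iota> CARD('n) U\<close> by (auto simp: is_system_def U)
  then have dim_dual: "vec.dim (dual_code C) = CARD('n) - CARD('k)"
    unfolding dual using dim_kernel_surjective_matrix surj_if_span_qspan_columns[OF \<iota>] by blast
  \<comment> \<open>The dual code has positive dimension since \<open>k < n\<close>, so its minimum
    distance is meaningful.\<close>
  have nonzero: "\<exists>c\<in>dual_code C. c \<noteq> 0"
  proof (rule ccontr)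
    assume "\<not> (\<exists>c\<in>dual_code C. c \<noteq> 0)"
    then have "vec.dim (dual_code C) = 0"
      by (auto simp: vec.dim_eq_0)
    then show False
      using dim_dual kn by simp
  qed
  have "scattered \<iota> h U \<longleftrightarrow>
      (\<forall>S\<subseteq>U. \<not> module.dependent (qscale \<iota>) S \<and> card S \<le> Suc h \<longrightarrow> vec.independent S)"
    by (rule scattered_iff_independent[OF \<iota> hk]) (use dimU U kn hk in simp)
  also have "\<dots> \<longleftrightarrow> \<not> (\<exists>v. G *v v = 0 \<and> v \<noteq> 0 \<and> rank_weight \<iota> v \<le> Suc h)"
    unfolding U
  proof (intro iffI notI allI impI)
    assume ind: "\<forall>S\<subseteq>qspan_columns \<iota> G.
        \<not> module.dependent (qscale \<iota>) S \<and> card S \<le> Suc h \<longrightarrow> vec.independent S"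
      and "\<exists>v. G *v v = 0 \<and> v \<noteq> 0 \<and> rank_weight \<iota> v \<le> Suc h"
    then obtain v where v: "G *v v = 0" "v \<noteq> 0" "rank_weight \<iota> v \<le> Suc h"
      by blast
    obtain S where "S \<subseteq> qspan_columns \<iota> G" "\<not> module.dependent (qscale \<iota>) S"
      "card S = rank_weight \<iota> v" "vec.dependent S"
      using dependent_set_of_kernel_vector[OF \<iota> dimU v(1,2)] .
    then show False
      using ind v(3) by simp
  next
    fix S
    assume no: "\<nexists>v. G *v v = 0 \<and> v \<noteq> 0 \<and> rank_weight \<iota> v \<le> Suc h"
      and S: "S \<subseteq> qspan_columns \<iota> G" and "vec.dependent S"
      and ind: "\<not> module.dependent (qscale \<iota>) S \<and> card S \<le> Suc h"
    then obtain v where "G *v v = 0" "v \<noteq> 0" "rank_weight \<iota> v \<le> card S"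
      using kernel_vector_of_dependent_set[OF \<iota>] by metis
    then show False
      using no ind le_trans by blast
  qed
  also have "\<dots> \<longleftrightarrow> \<not> min_rank_distance \<iota> (dual_code C) \<le> Suc h"
    by (simp add: min_rank_distance_le_iff[OF nonzero]) (simp add: dual)
  also have "\<dots> \<longleftrightarrow> Rdef \<iota> m (dual_code C) \<le> \<lfloor>real (CARD('k) * m) / real CARD('n)\<rfloor> - int h - 1"
  proof -
    \<comment> \<open>Rounding \<open>m - km/n\<close> up gives \<open>m\<close> minus the floor of
      \<open>km/n\<close>. The bound on the defect then reads \<open>d \<ge> h + 2\<close> for the
      minimum distance \<open>d\<close>, the negation of \<open>d \<le> Suc h\<close>.\<close>
    have "real ((CARD('n) - CARD('k)) * m) / real CARD('n)
        = of_int (int m) - real (CARD('k) * m) / real CARD('n)"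
      using kn by (simp add: of_nat_diff field_simps)
    then have "\<lceil>real (vec.dim (dual_code C) * m) / real CARD('n)\<rceil>
        = int m - \<lfloor>real (CARD('k) * m) / real CARD('n)\<rfloor>"
      unfolding dim_dual by (simp only: ceiling_def) linarith
    then show ?thesis
      unfolding Rdef_def by linarith
  qed
  finally show ?thesis .
qed

end
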